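(* For every positive integer $n$, $$a(n)<e^{\pi\sqrt{n}},$$ where $a(n)$ denotes the number of cubic partitions of $n$.
   Context: For an integer $m\ge 0$, $a(m)$ (the number of cubic partitions of $m$) is the number of partitions of $m$ in which every even part may carry one of two labels (colours), with $a(0)=1$. Equivalently, the integers $a(m)$ are defined by the generating function $$\sum_{m=0}^{\infty}a(m)x^{m}=\prod_{i=1}^{\infty}\frac{1}{(1-x^{i})(1-x^{2i})},\qquad |x|<1.$$ *)

theory Defs
  imports Complex_Main "HOL-Library.Multiset"
begin

text \<open>A coloured part is a pair of its size and its colour. Even parts come in the two colours
  \<open>False\<close> and \<open>True\<close>; odd parts only in the colour \<open>False\<close>.\<close>

definition cubic_partitions :: "nat \<Rightarrow> (nat \<times> bool) multiset set" where
  "cubic_partitions m =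
    {P. (\<forall>(i, c) \<in> set_mset P. 0 < i \<and> (odd i \<longrightarrow> \<not> c)) \<and> (\<Sum>(i, c) \<in># P. i) = m}"

definition cubic_partition_count :: "nat \<Rightarrow> nat" where
  "cubic_partition_count m = card (cubic_partitions m)"

text \<open>Since \<open>card\<close> is \<open>0\<close> on infinite sets, finiteness is needed for the count to be meaningful.\<close>

lemma finite_cubic_partitions: "finite (cubic_partitions m)"
proof -
  have size_le: "size P \<le> (\<Sum>(i, c) \<in># P. i)"
    if "\<forall>(i, c) \<in> set_mset P. 0 < i" for P :: "(nat \<times> bool) multiset"
    using that by (induction P) auto
  have part_le: "i \<le> (\<Sum>(i, c) \<in># P. i)"
    if "(i, c) \<in># P" for i c and P :: "(nat \<times> bool) multiset"
    using that by (induction P) auto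
  have "cubic_partitions m \<subseteq> mset ` {xs. set xs \<subseteq> {..m} \<times> UNIV \<and> length xs \<le> m}"
  proof
    fix P assume P: "P \<in> cubic_partitions m"
    obtain xs where xs: "P = mset xs" using ex_mset by metis
    have "size P \<le> m"
      using size_le[of P] P by (auto simp: cubic_partitions_def)
    moreover have "set_mset P \<subseteq> {..m} \<times> UNIV"
      using part_le[of _ _ P] P by (auto simp: cubic_partitions_def)
    ultimately show "P \<in> mset ` {xs. set xs \<subseteq> {..m} \<times> UNIV \<and> length xs \<le> m}"
      using xs by auto
  qed
  moreover have "finite {xs. set xs \<subseteq> {..m} \<times> (UNIV :: bool set) \<and> length xs \<le> m}"
    by (rule finite_lists_length_le) auto
  ultimately show ?thesis by (meson finite_imageI finite_subset)
qed

lemma cubic_partition_count_0: "cubic_partition_count 0 = 1"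
proof -
  have "cubic_partitions 0 = {{#}}"
  proof (rule set_eqI)
    fix P show "P \<in> cubic_partitions 0 \<longleftrightarrow> P \<in> {{#}}"
      by (cases P) (auto simp: cubic_partitions_def)
  qed
  then show ?thesis by (simp add: cubic_partition_count_def)
qed

end

theory Submission
  imports Defs "HOL-Analysis.Complex_Transcendental" "HOL-Analysis.Gamma_Function"
begin

text \<open>Write \<open>F(x)\<close> for the generating function. Since all its coefficients are nonnegative,
  \<open>a(n) < F(x) / x ^ n\<close> for \<open>0 < x < 1\<close> (Rankin's trick). At \<open>x = exp (-t)\<close>, expanding the
  logarithm of the product and using \<open>1 / (exp (k t) - 1) \<le> 1 / (k t)\<close> together with
  \<open>\<Sum>k. 1 / k\<^sup>2 = pi\<^sup>2 / 6\<close> gives \<open>ln F(exp (-t)) \<le> pi\<^sup>2 / (6 t) + pi\<^sup>2 / (12 t) = pi\<^sup>2 / (4 t)\<close>.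
  The choice \<open>t = pi / (2 sqrt n)\<close> minimises \<open>n t + pi\<^sup>2 / (4 t)\<close>, with value \<open>pi sqrt n\<close>.\<close>

text \<open>Expanding every factor as a geometric series turns the product into the total weight of
  all finite multisets over \<open>S\<close>; the finite family \<open>A\<close> collects some of
  these nonnegative terms. Finite families keep the argument free of infinite sums over
  multisets.\<close>

lemma sum_prod_mset_le_prod_geometric:
  fixes w :: "'a \<Rightarrow> real"
  assumes "finite S" "finite A" "\<And>s. s \<in> S \<Longrightarrow> 0 \<le> w s \<and> w s < 1"
    and "\<And>P. P \<in> A \<Longrightarrow> set_mset P \<subseteq> S"
  shows "(\<Sum>P\<in>A. \<Prod>p\<in>#P. w p) \<le> (\<Prod>s\<in>S. 1 / (1 - w s))"
  using assms
proof (induction S arbitrary: A rule: finite_induct)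
  case empty
  then have "A \<subseteq> {{#}}" by auto
  then have "A = {} \<or> A = {{#}}" by auto
  then show ?case by auto
next
  case (insert s S)
  define B where "B = filter_mset (\<lambda>p. p \<noteq> s) ` A"
  define K where "K = (\<lambda>P. count P s) ` A"
  have ws: "0 \<le> w s" "w s < 1" and wS: "\<And>p. p \<in> S \<Longrightarrow> 0 \<le> w p \<and> w p < 1"
    using insert.prems by auto
  have fin: "finite B" "finite K"
    using insert.prems by (auto simp: B_def K_def)
  have BS: "set_mset P \<subseteq> S" if "P \<in> B" for P
    using that insert.prems(3) by (fastforce simp: B_def)
  have nonneg: "0 \<le> (\<Prod>p\<in>#Q. w p)" if "set_mset Q \<subseteq> S" for Q
    using that wS by (induction Q) auto
  \<comment> \<open>Splitting off the copies of \<open>s\<close> embeds \<open>A\<close> in the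
    rectangle \<open>K \<times> B\<close>, over which the weight sum factors into a partial
    geometric sum in \<open>w s\<close> and a sum covered by the induction hypothesis.\<close>
  define g where "g = (\<lambda>P. (count P s, filter_mset (\<lambda>p. p \<noteq> s) P))"
  have split: "P = replicate_mset (count P s) s + filter_mset (\<lambda>p. p \<noteq> s) P" for P
    by (rule multiset_eqI) auto
  have "inj_on g A"
  proof (rule inj_on_inverseI)
    show "(\<lambda>(k, Q). replicate_mset k s + Q) (g P) = P" for P
      unfolding g_def prod.case by (rule split[symmetric])
  qed
  have weight: "(\<Prod>p\<in>#P. w p) = (case g P of (k, Q) \<Rightarrow> w s ^ k * (\<Prod>p\<in>#Q. w p))" for P
  proof -
    have "(\<Prod>p\<in>#P. w p)
        = (\<Prod>p\<in>#replicate_mset (count P s) s + filter_mset (\<lambda>p. p \<noteq> s) P. w p)"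
      by (subst split[of P]) (rule refl)
    then show ?thesis by (simp add: g_def)
  qed
  have "(\<Sum>P\<in>A. \<Prod>p\<in>#P. w p) = (\<Sum>(k, Q)\<in>g ` A. w s ^ k * (\<Prod>p\<in>#Q. w p))"
    unfolding sum.reindex[OF \<open>inj_on g A\<close>] comp_def by (rule sum.cong[OF refl weight])
  also have "\<dots> \<le> (\<Sum>(k, Q)\<in>K \<times> B. w s ^ k * (\<Prod>p\<in>#Q. w p))"
  proof (rule sum_mono2)
    show "g ` A \<subseteq> K \<times> B" by (auto simp: g_def K_def B_def)
    fix kQ assume "kQ \<in> K \<times> B - g ` A"
    then show "0 \<le> (case kQ of (k, Q) \<Rightarrow> w s ^ k * (\<Prod>p\<in>#Q. w p))"
      using nonneg BS ws by auto
  qed (use fin in auto)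
  also have "\<dots> = (\<Sum>k\<in>K. w s ^ k) * (\<Sum>Q\<in>B. \<Prod>p\<in>#Q. w p)"
    by (simp add: sum_product sum.cartesian_product)
  also have "\<dots> \<le> 1 / (1 - w s) * (\<Prod>p\<in>S. 1 / (1 - w p))"
  proof (rule mult_mono')
    have "(\<Sum>k\<in>K. w s ^ k) \<le> (\<Sum>k. w s ^ k)"
      using ws fin by (intro sum_le_suminf summable_geometric) auto
    then show "(\<Sum>k\<in>K. w s ^ k) \<le> 1 / (1 - w s)"
      using ws by (simp add: suminf_geometric)
    show "(\<Sum>Q\<in>B. \<Prod>p\<in>#Q. w p) \<le> (\<Prod>p\<in>S. 1 / (1 - w p))"
      using insert.IH fin wS BS by blast
    show "0 \<le> (\<Sum>k\<in>K. w s ^ k)" using ws by (intro sum_nonneg) auto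
    show "0 \<le> (\<Sum>Q\<in>B. \<Prod>p\<in>#Q. w p)" using nonneg BS by (intro sum_nonneg) blast
  qed
  also have "\<dots> = (\<Prod>p\<in>insert s S. 1 / (1 - w p))"
    using insert.hyps by simp
  finally show ?case .
qed

text \<open>The full series has sum \<open>1 / (exp u - 1)\<close>, and
  \<open>exp u \<ge> 1 + u\<close>.\<close>

lemma sum_power_exp_le:
  fixes u :: real
  assumes "u > 0"
  shows "(\<Sum>i=1..n. exp (-u) ^ i) \<le> 1 / u"
proof -
  define y where "y = exp (-u)"
  have y: "0 < y" "y < 1" using assms by (auto simp: y_def)
  have "(\<Sum>i=1..n. y ^ i) = y * (\<Sum>i<n. y ^ i)"
    by (simp add: sum_distrib_left sum.atLeast1_atMost_eq)
  also have "\<dots> \<le> y * (\<Sum>i. y ^ i)"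
    using y by (intro mult_left_mono sum_le_suminf summable_geometric) auto
  also have "\<dots> = y / (1 - y)"
    using y by (simp add: suminf_geometric)
  also have "\<dots> \<le> 1 / u"
  proof -
    have "1 + u \<le> exp u" by (rule exp_ge_add_one_self)
    then have "(1 + u) * y \<le> 1"
      using y by (simp add: y_def exp_minus field_simps)
    then show ?thesis using y assms by (simp add: field_simps)
  qed
  finally show ?thesis by (simp add: y_def)
qed

lemma prod_one_minus_exp_power_le:
  fixes t :: real
  assumes "t > 0"
  shows "(\<Prod>i=1..n. 1 / (1 - exp (-t) ^ i)) \<le> exp (pi\<^sup>2 / (6 * t))"
proof -
  define y where "y = exp (-t)"
  have yi: "0 < y ^ i" "y ^ i < 1" if "i \<ge> 1" for i
    using that assms by (auto simp: y_def power_less_one_iff)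
  have "(\<lambda>k. (y ^ i) ^ Suc k / real (Suc k)) sums - ln (1 - y ^ i)" if "i \<ge> 1" for i
  proof -
    \<comment> \<open>The term at \<open>k = 0\<close> is a division by zero, hence
      \<open>0\<close>, so the index can be shifted to start the series at exponent 1.\<close>
    have "(\<lambda>k. - ((- (- (y ^ i))) ^ k) / of_nat k) sums ln (1 + - (y ^ i))"
      using yi[OF that] by (intro ln_series') auto
    then have "(\<lambda>k. (y ^ i) ^ k / real k) sums - ln (1 - y ^ i)"
      by (auto dest: sums_minus)
    then show ?thesis by (subst sums_Suc_iff) auto
  qed
  then have "(\<lambda>k. \<Sum>i=1..n. (y ^ i) ^ Suc k / real (Suc k)) sums (\<Sum>i=1..n. - ln (1 - y ^ i))"
    by (intro sums_sum) auto
  moreover have "(\<lambda>k. 1 / t * (1 / (real k + 1)\<^sup>2)) sums (1 / t * (pi\<^sup>2 / 6))"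
    using inverse_squares_sums by (intro sums_mult) (simp add: add.commute)
  moreover have "(\<Sum>i=1..n. (y ^ i) ^ Suc k / real (Suc k)) \<le> 1 / t * (1 / (real k + 1)\<^sup>2)" for k
  proof -
    \<comment> \<open>With the order of summation exchanged, the sum over \<open>i\<close> for fixed
      \<open>k\<close> is geometric with ratio \<open>y ^ Suc k\<close>, so the preceding bound
      applies with \<open>u = real (Suc k) * t\<close>.\<close>
    have "y ^ Suc k = exp (- (real (Suc k) * t))"
      unfolding y_def by (subst exp_of_nat_mult[symmetric]) simp
    then have "(\<Sum>i=1..n. (y ^ i) ^ Suc k / real (Suc k))
        = (\<Sum>i=1..n. exp (- (real (Suc k) * t)) ^ i) / real (Suc k)"
      by (simp only: sum_divide_distrib power_mult[symmetric] mult.commute[of _ "Suc k"])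
        (simp only: power_mult)
    also have "\<dots> \<le> 1 / (real (Suc k) * t) / real (Suc k)"
      using assms by (intro divide_right_mono sum_power_exp_le) auto
    also have "\<dots> = 1 / t * (1 / (real k + 1)\<^sup>2)"
      by (simp add: power2_eq_square mult_ac add.commute)
    finally show ?thesis .
  qed
  ultimately have "(\<Sum>i=1..n. - ln (1 - y ^ i)) \<le> 1 / t * (pi\<^sup>2 / 6)"
    by (rule sums_le[rotated])
  then have "exp (\<Sum>i=1..n. - ln (1 - y ^ i)) \<le> exp (pi\<^sup>2 / (6 * t))"
    by (simp add: mult.commute)
  also have "exp (\<Sum>i=1..n. - ln (1 - y ^ i)) = (\<Prod>i=1..n. 1 / (1 - y ^ i))"
    using yi by (subst exp_sum) (auto intro!: prod.cong simp: exp_minus inverse_eq_divide)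
  finally show ?thesis by (simp add: y_def)
qed

text \<open>Parts of a partition of \<open>n\<close> have size at most \<open>n\<close>, so finite
  products suffice. The extra 1 is the constant term of the generating function; it later makes the
  final inequality strict.\<close>

lemma cubic_partition_count_generating_bound:
  fixes x :: real
  assumes "0 < x" "x < 1" "n > 0"
  shows "1 + real (cubic_partition_count n) * x ^ n
    \<le> (\<Prod>i=1..n. 1 / (1 - x ^ i)) * (\<Prod>i=1..n. 1 / (1 - (x\<^sup>2) ^ i))"
proof -
  \<comment> \<open>The two colours give the two products. Sizes \<open>2 * i\<close> of colour
    \<open>True\<close> run up to \<open>2 * n\<close>, so that both products have the same index
    range.\<close>
  define S where "S = (\<lambda>i. (i, False)) ` {1..n} \<union> (\<lambda>i. (2 * i, True)) ` {1..n}"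
  define w where "w = (\<lambda>(i, c :: bool). x ^ i)"
  have part_le: "i \<le> (\<Sum>(i, c) \<in># P. i)" if "(i, c) \<in># P" for i c and P :: "(nat \<times> bool) multiset"
    using that by (induction P) auto
  have "set_mset P \<subseteq> S" if P: "P \<in> cubic_partitions n" for P
  proof
    fix p assume p: "p \<in># P"
    obtain i c where ic: "p = (i, c)" by (cases p)
    have "0 < i" "odd i \<longrightarrow> \<not> c" "i \<le> n"
      using P p part_le[of i c P] by (auto simp: cubic_partitions_def ic)
    then show "p \<in> S" by (cases c) (auto simp: ic S_def elim!: evenE)
  qed
  then have sub: "\<And>P. P \<in> insert {#} (cubic_partitions n) \<Longrightarrow> set_mset P \<subseteq> S" by auto
  have w01: "\<And>s. s \<in> S \<Longrightarrow> 0 \<le> w s \<and> w s < 1"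
    using assms by (auto simp: S_def w_def power_less_one_iff)
  have finS: "finite S" by (simp add: S_def)
  have "(\<Prod>p\<in>#P. w p) = x ^ (\<Sum>(i, c) \<in># P. i)" for P
    by (induction P) (auto simp: w_def power_add)
  then have "(\<Sum>P\<in>cubic_partitions n. \<Prod>p\<in>#P. w p) = real (cubic_partition_count n) * x ^ n"
    by (simp add: cubic_partition_count_def cubic_partitions_def)
  \<comment> \<open>As \<open>n > 0\<close>, the empty multiset can be adjoined as a new element,
    contributing the weight 1.\<close>
  moreover have "{#} \<notin> cubic_partitions n"
    using assms by (simp add: cubic_partitions_def)
  ultimately have "1 + real (cubic_partition_count n) * x ^ n
      = (\<Sum>P\<in>insert {#} (cubic_partitions n). \<Prod>p\<in>#P. w p)"
    by (simp add: finite_cubic_partitions)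
  also have "\<dots> \<le> (\<Prod>s\<in>S. 1 / (1 - w s))"
    using finS w01 sub by (intro sum_prod_mset_le_prod_geometric) (auto simp: finite_cubic_partitions)
  also have "\<dots> = (\<Prod>i=1..n. 1 / (1 - x ^ i)) * (\<Prod>i=1..n. 1 / (1 - (x\<^sup>2) ^ i))"
    unfolding S_def
    by (subst prod.union_disjoint) (auto simp: prod.reindex inj_on_def w_def power_mult)
  finally show ?thesis .
qed

theorem theorem1p3:
  fixes n :: nat
  assumes "n > 0"
  shows "real (cubic_partition_count n) < exp (pi * sqrt (real n))"
proof -
  define t where "t = pi / (2 * sqrt (real n))"
  have t: "t > 0" using assms by (simp add: t_def)
  \<comment> \<open>The product for the second colour is thus the first one with
    \<open>2 * t\<close> in place of \<open>t\<close>.\<close>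
  have sq: "(exp (-t))\<^sup>2 = exp (- (2 * t))"
    by (simp add: exp_double[symmetric])
  have "1 + real (cubic_partition_count n) * exp (-t) ^ n
      \<le> exp (pi\<^sup>2 / (6 * t)) * exp (pi\<^sup>2 / (6 * (2 * t)))"
  proof (rule order_trans[OF cubic_partition_count_generating_bound])
    show "(\<Prod>i=1..n. 1 / (1 - exp (-t) ^ i)) * (\<Prod>i=1..n. 1 / (1 - ((exp (-t))\<^sup>2) ^ i))
        \<le> exp (pi\<^sup>2 / (6 * t)) * exp (pi\<^sup>2 / (6 * (2 * t)))"
      unfolding sq using t
      by (intro mult_mono prod_one_minus_exp_power_le prod_nonneg) (auto simp: power_le_one)
  qed (use t assms in auto)
  also have "\<dots> = exp (pi\<^sup>2 / (4 * t))"
    using t by (simp add: exp_add[symmetric] field_simps)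
  finally have "real (cubic_partition_count n) * exp (-t) ^ n < exp (pi\<^sup>2 / (4 * t))"
    by simp
  moreover have "exp (-t) ^ n = exp (- (real n * t))"
    by (subst exp_of_nat_mult[symmetric]) simp
  ultimately have "real (cubic_partition_count n) < exp (pi\<^sup>2 / (4 * t)) * exp (real n * t)"
    by (simp add: exp_minus field_simps)
  also have "\<dots> = exp (pi\<^sup>2 / (4 * t) + real n * t)"
    by (simp add: exp_add)
  \<comment> \<open>At this \<open>t\<close> both summands equal
    \<open>pi * sqrt (real n) / 2\<close>.\<close>
  also have "pi\<^sup>2 / (4 * t) + real n * t = pi * sqrt (real n)"
    using assms by (simp add: t_def field_simps power2_eq_square)
  finally show ?thesis .
qed

end
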